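(* Let $\ell:\mathcal A\times\{0,1\}\to[0,1]$ be a fixed loss whose best responses are attained, let $\mathcal H$ be a class of functions $\mathcal X\to\mathcal A$, and let $(\lambda_\ell,\tau_\ell,\rho_\ell)$ be the canonical properization of $\ell$. Then for every transcript $(x_t,p_t,y_t)_{t=1}^T$ with $p_t\in\mathcal P\subseteq[0,1]$, $$\mathrm{SwapReg}_T^{\mathrm{br}}(\ell,\mathcal H)\ \le\ \mathrm{SwapReg}_T(\lambda_\ell,\rho_\ell\circ\mathcal H;\tau_\ell).$$ Consequently, any swap-regret bound for the single proper loss $\lambda_\ell$ and the transformed comparator class $\rho_\ell\circ\mathcal H$ gives the same bound for the original loss $\ell$, provided the learner plays $k_\ell(p)$ after forecasting $p$.
   Context: $\mathcal P\subseteq[0,1]$ is the set of prediction values used by the learner; $x_t\in\mathcal X$, $y_t\in\{0,1\}$. Write $L_p^\ell(a)=(1-p)\ell(a,0)+p\,\ell(a,1)$ and $s_\ell(a)=\ell(a,0)-\ell(a,1)$. Best responses are attained means that for every $p\in[0,1]$ there is a (fixed) choice $k_\ell(p)\in\operatorname{arg\,min}_{a\in\mathcal A}L_p^\ell(a)$. Canonical properization: let $F_\ell(p)=-\min_aL_p^\ell(a)$, $F_\ell^*(s)=\sup_{q\in[0,1]}\{qs-F_\ell(q)\}$, $\mathcal S_\ell=\{s_\ell(a):a\in\mathcal A\}$, $Q_\ell(s)=\operatorname{arg\,max}_{q\in[0,1]}\{qs-F_\ell(q)\}$ (nonempty for $s\in\mathcal S_\ell$), $\mathcal R_\ell=\{(q,s):s\in\mathcal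 S_\ell,q\in Q_\ell(s)\}$, $\lambda_\ell((q,s),y)=F_\ell^*(s)-sy$ for $(q,s)\in\mathcal R_\ell$, $\tau_\ell(p)=(p,s_\ell(k_\ell(p)))\in\mathcal R_\ell$, and $\rho_\ell(a)=(q_\ell(a),s_\ell(a))$ for a fixed choice $q_\ell(a)\in Q_\ell(s_\ell(a))$. Put $\rho_\ell\circ\mathcal H=\{x\mapsto\rho_\ell(h(x)):h\in\mathcal H\}$. Regrets: $$\mathrm{SwapReg}_T^{\mathrm{br}}(\ell,\mathcal H)=\sup_{\phi:\mathcal P\to\mathcal H}\sum_{t=1}^T\big[\ell(k_\ell(p_t),y_t)-\ell(\phi(p_t)(x_t),y_t)\big],$$ $$\mathrm{SwapReg}_T(\lambda,\mathcal G;\tau)=\sup_{\psi:\mathcal P\to\mathcal G}\sum_{t=1}^T\big[\lambda(\tau(p_t),y_t)-\lambda(\psi(p_t)(x_t),y_t)\big].$$ *)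

theory Defs
  imports Complex_Main "HOL-Library.FuncSet" "HOL-Library.Extended_Real"
begin

text \<open>
  The action set \<open>\<A>\<close> is the type \<open>'a\<close>, the feature space is the type \<open>'x\<close>. Labels are natural
  numbers, of which only 0 and 1 matter: theorems guard them by \<open>y \<in> {0, 1}\<close>.
\<close>

definition exp_loss :: "('a \<Rightarrow> nat \<Rightarrow> real) \<Rightarrow> real \<Rightarrow> 'a \<Rightarrow> real"
  where "exp_loss loss p a = (1 - p) * loss a 0 + p * loss a 1"

definition slope :: "('a \<Rightarrow> nat \<Rightarrow> real) \<Rightarrow> 'a \<Rightarrow> real"
  where "slope loss a = loss a 0 - loss a 1"

definition best_response :: "('a \<Rightarrow> nat \<Rightarrow> real) \<Rightarrow> (real \<Rightarrow> 'a) \<Rightarrow> bool"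
  where "best_response loss k \<longleftrightarrow> (\<forall>p\<in>{0..1}. is_arg_min (exp_loss loss p) (\<lambda>_. True) (k p))"

text \<open>
  The infimum below is a minimum for \<open>p \<in> [0,1]\<close> whenever best responses are attained. For losses
  with values in \<open>[0,1]\<close>, the real-valued infimum and supremum below are over nonempty bounded
  sets (the supremum for \<open>s\<close> any real number).
\<close>

definition F_loss :: "('a \<Rightarrow> nat \<Rightarrow> real) \<Rightarrow> real \<Rightarrow> real"
  where "F_loss loss p = - (INF a. exp_loss loss p a)"

definition F_conj :: "('a \<Rightarrow> nat \<Rightarrow> real) \<Rightarrow> real \<Rightarrow> real"
  where "F_conj loss s = (SUP q\<in>{0..1}. q * s - F_loss loss q)"

definition slopes :: "('a \<Rightarrow> nat \<Rightarrow> real) \<Rightarrow> real set"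
  where "slopes loss = range (slope loss)"

definition conj_argmax :: "('a \<Rightarrow> nat \<Rightarrow> real) \<Rightarrow> real \<Rightarrow> real set"
  where "conj_argmax loss s = {q. is_arg_max (\<lambda>q. q * s - F_loss loss q) (\<lambda>q. q \<in> {0..1}) q}"

definition reports :: "('a \<Rightarrow> nat \<Rightarrow> real) \<Rightarrow> (real \<times> real) set"
  where "reports loss = {(q, s). s \<in> slopes loss \<and> q \<in> conj_argmax loss s}"

text \<open>
  The canonical properization \<open>(\<lambda>, \<tau>, \<rho>)\<close>. The proper loss is left unspecified off its domain
  \<^term>\<open>reports loss\<close>, so that evaluating it presupposes membership in that domain.
\<close>

definition proper_loss :: "('a \<Rightarrow> nat \<Rightarrow> real) \<Rightarrow> real \<times> real \<Rightarrow> nat \<Rightarrow> real"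
  where "proper_loss loss r y =
    (if r \<in> reports loss then F_conj loss (snd r) - snd r * real y else undefined)"

definition forecast_report :: "('a \<Rightarrow> nat \<Rightarrow> real) \<Rightarrow> (real \<Rightarrow> 'a) \<Rightarrow> real \<Rightarrow> real \<times> real"
  where "forecast_report loss k p = (p, slope loss (k p))"

definition action_report :: "('a \<Rightarrow> nat \<Rightarrow> real) \<Rightarrow> ('a \<Rightarrow> real) \<Rightarrow> 'a \<Rightarrow> real \<times> real"
  where "action_report loss q a = (q a, slope loss a)"

definition comp_class :: "('a \<Rightarrow> 'b) \<Rightarrow> ('x \<Rightarrow> 'a) set \<Rightarrow> ('x \<Rightarrow> 'b) set"
  where "comp_class \<rho> H = (\<lambda>h x. \<rho> (h x)) ` H"

definition transcript :: "real set \<Rightarrow> nat \<Rightarrow> (nat \<Rightarrow> 'x) \<Rightarrow> (nat \<Rightarrow> real) \<Rightarrow> (nat \<Rightarrow> nat) \<Rightarrow> bool"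
  where "transcript P T x p y \<longleftrightarrow> (\<forall>t\<in>{1..T}. p t \<in> P \<and> y t \<in> {0, 1})"

text \<open>
  The supremum is taken in the extended reals, so that it is \<open>-\<infinity>\<close> when there is no map
  \<open>P \<rightarrow> G\<close> (an empty class \<open>G\<close> and nonempty \<open>P\<close>).
\<close>

definition swap_reg ::
    "real set \<Rightarrow> ('b \<Rightarrow> nat \<Rightarrow> real) \<Rightarrow> ('x \<Rightarrow> 'b) set \<Rightarrow> (real \<Rightarrow> 'b)
      \<Rightarrow> nat \<Rightarrow> (nat \<Rightarrow> 'x) \<Rightarrow> (nat \<Rightarrow> real) \<Rightarrow> (nat \<Rightarrow> nat) \<Rightarrow> ereal"
  where "swap_reg P \<Lambda> G \<tau> T x p y =
    (SUP \<psi>\<in>P \<rightarrow> G. ereal (\<Sum>t=1..T. \<Lambda> (\<tau> (p t)) (y t) - \<Lambda> (\<psi> (p t) (x t)) (y t)))"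

definition swap_reg_br ::
    "real set \<Rightarrow> ('a \<Rightarrow> nat \<Rightarrow> real) \<Rightarrow> ('x \<Rightarrow> 'a) set \<Rightarrow> (real \<Rightarrow> 'a)
      \<Rightarrow> nat \<Rightarrow> (nat \<Rightarrow> 'x) \<Rightarrow> (nat \<Rightarrow> real) \<Rightarrow> (nat \<Rightarrow> nat) \<Rightarrow> ereal"
  where "swap_reg_br P loss H k T x p y =
    (SUP \<phi>\<in>P \<rightarrow> H. ereal (\<Sum>t=1..T. loss (k (p t)) (y t) - loss (\<phi> (p t) (x t)) (y t)))"

end

theory Submission
  imports Defs
begin

text \<open>
  As a function of \<open>p\<close>, the expected loss of an action \<open>a\<close> is the line \<open>loss a 0 - p * slope loss a\<close>.
  It lies above \<open>- F_loss loss\<close>, so the conjugate at its slope is at most its intercept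
  \<open>loss a 0\<close>, with equality, attained at \<open>p\<close>, if \<open>a\<close> is a best response to \<open>p\<close>. Hence
  properization preserves the losses of the learner and does not increase those of the comparators.
\<close>

lemma exp_loss_slope: "exp_loss loss p a = loss a 0 - p * slope loss a"
  by (simp add: exp_loss_def slope_def algebra_simps)

text \<open>Interpolating between the two labels gives the loss the affine form in \<open>y\<close>
  that \<open>proper_loss\<close> has, so with equal slopes only the intercepts remain to be
  compared.\<close>

lemma loss_eq_slope: "y \<in> {0, 1} \<Longrightarrow> loss a y = loss a 0 - slope loss a * real y"
  by (auto simp: slope_def)

lemma best_responseD:
  assumes "best_response loss k" "p \<in> {0..1}"
  shows "exp_loss loss p (k p) \<le> exp_loss loss p a"
  using assms by (auto simp: best_response_def is_arg_min_linorder)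

text \<open>The infimum over actions is attained at \<open>k p\<close>, so the minimum can replace
  \<open>INF\<close> in the later computations.\<close>

lemma F_loss_best_response:
  assumes "best_response loss k" "p \<in> {0..1}"
  shows "F_loss loss p = - exp_loss loss p (k p)"
  unfolding F_loss_def using best_responseD[OF assms]
  by (auto intro!: cInf_eq_minimum)

text \<open>Adding \<open>p * slope loss a\<close> to the line of \<open>a\<close> cancels its
  dependence on \<open>p\<close>. The resulting bound is uniform in \<open>p\<close> and hence
  bounds the supremum in \<open>F_conj\<close>.\<close>

lemma conj_objective_le:
  assumes "best_response loss k" "p \<in> {0..1}"
  shows "p * slope loss a - F_loss loss p \<le> loss a 0"
  using F_loss_best_response[OF assms] best_responseD[OF assms, of a]
  by (simp add: exp_loss_slope[of loss p a])

lemma conj_objective_best_response: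
  assumes "best_response loss k" "p \<in> {0..1}"
  shows "p * slope loss (k p) - F_loss loss p = loss (k p) 0"
  by (simp add: F_loss_best_response[OF assms] exp_loss_slope)

lemma F_conj_slope_le:
  assumes "best_response loss k"
  shows "F_conj loss (slope loss a) \<le> loss a 0"
  unfolding F_conj_def by (rule cSUP_least) (auto intro: conj_objective_le[OF assms])

lemma F_conj_slope_best_response:
  assumes "best_response loss k" "p \<in> {0..1}"
  shows "F_conj loss (slope loss (k p)) = loss (k p) 0"
  unfolding F_conj_def
proof (rule cSup_eq_maximum)
  show "loss (k p) 0 \<in> (\<lambda>q. q * slope loss (k p) - F_loss loss q) ` {0..1}"
    using assms(2) conj_objective_best_response[OF assms, symmetric]
    by (rule rev_image_eqI)
qed (auto intro: conj_objective_le[OF assms(1)])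

text \<open>\<open>proper_loss\<close> is specified only on \<open>reports loss\<close>, so
  membership comes before evaluation. The conjugate objective at the slope of \<open>k p\<close>
  reaches its uniform upper bound \<open>loss (k p) 0\<close> at \<open>p\<close>, which makes
  \<open>p\<close> a maximizer.\<close>

lemma forecast_report_in_reports:
  assumes "best_response loss k" "p \<in> {0..1}"
  shows "forecast_report loss k p \<in> reports loss"
  using assms conj_objective_le[OF assms(1), of _ "k p"] conj_objective_best_response[OF assms]
  by (auto simp: forecast_report_def reports_def slopes_def conj_argmax_def is_arg_max_linorder)

lemma proper_loss_forecast_report:
  assumes "best_response loss k" "p \<in> {0..1}" "y \<in> {0, 1}"
  shows "proper_loss loss (forecast_report loss k p) y = loss (k p) y"
  using forecast_report_in_reports[OF assms(1,2)] F_conj_slope_best_response[OF assms(1,2)]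
    loss_eq_slope[OF assms(3), of loss "k p"]
  by (simp add: proper_loss_def forecast_report_def)

text \<open>Only an inequality can be expected here: if \<open>a\<close> is not a best response to
  any forecast, its line stays strictly above the minimum and the conjugate falls below
  \<open>loss a 0\<close>.\<close>

lemma proper_loss_action_report_le:
  assumes "best_response loss k" "q a \<in> conj_argmax loss (slope loss a)" "y \<in> {0, 1}"
  shows "proper_loss loss (action_report loss q a) y \<le> loss a y"
proof -
  have "action_report loss q a \<in> reports loss"
    using assms(2) by (auto simp: action_report_def reports_def slopes_def)
  then show ?thesis
    using F_conj_slope_le[OF assms(1), of a] loss_eq_slope[OF assms(3), of loss a]
    by (simp add: proper_loss_def action_report_def)
qed

lemma swap_reg_br_le_swap_reg:
  assumes br: "best_response loss k"
    and q_choice: "\<And>a. q a \<in> conj_argmax loss (slope loss a)"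
    and P_sub: "P \<subseteq> {0..1}"
    and tr: "transcript P T x p y"
  shows "swap_reg_br P loss H k T x p y
    \<le> swap_reg P (proper_loss loss) (comp_class (action_report loss q) H)
        (forecast_report loss k) T x p y"
  unfolding swap_reg_br_def swap_reg_def
proof (rule SUP_mono)
  fix \<phi> assume \<phi>: "\<phi> \<in> P \<rightarrow> H"
  \<comment> \<open>Each swap map into \<open>H\<close> is matched with its composition with the
    action report, so the suprema compare even when they are infinite.\<close>
  let ?\<psi> = "\<lambda>u z. action_report loss q (\<phi> u z)"
  have "?\<psi> \<in> P \<rightarrow> comp_class (action_report loss q) H"
    using \<phi> by (auto simp: comp_class_def)
  moreover have "(\<Sum>t=1..T. loss (k (p t)) (y t) - loss (\<phi> (p t) (x t)) (y t))
      \<le> (\<Sum>t=1..T. proper_loss loss (forecast_report loss k (p t)) (y t)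
             - proper_loss loss (?\<psi> (p t) (x t)) (y t))"
  proof (rule sum_mono)
    fix t assume "t \<in> {1..T}"
    then have "p t \<in> {0..1}" "y t \<in> {0, 1}"
      using tr P_sub unfolding transcript_def by blast+
    \<comment> \<open>Round by round, the learner's term is unchanged and the subtracted comparator
      term can only shrink.\<close>
    then show "loss (k (p t)) (y t) - loss (\<phi> (p t) (x t)) (y t)
      \<le> proper_loss loss (forecast_report loss k (p t)) (y t)
         - proper_loss loss (?\<psi> (p t) (x t)) (y t)"
      using proper_loss_forecast_report[OF br, of "p t" "y t"]
        proper_loss_action_report_le[where q = q and a = "\<phi> (p t) (x t)" and y = "y t", OF br q_choice]
      by linarith
  qed
  ultimately show "\<exists>\<psi>\<in>P \<rightarrow> comp_class (action_report loss q) H.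
      ereal (\<Sum>t=1..T. loss (k (p t)) (y t) - loss (\<phi> (p t) (x t)) (y t))
      \<le> ereal (\<Sum>t=1..T. proper_loss loss (forecast_report loss k (p t)) (y t)
             - proper_loss loss (\<psi> (p t) (x t)) (y t))"
    by (intro bexI[of _ ?\<psi>]) simp_all
qed

text \<open>The second conjunct expresses the transfer of bounds: \<open>\<T>\<close> is any set of
  transcripts, and \<open>B\<close> may depend on the whole transcript, so both worst-case and
  data-dependent bounds are covered.\<close>

theorem theorem7p4:
  fixes loss :: "'a \<Rightarrow> nat \<Rightarrow> real"
    and k :: "real \<Rightarrow> 'a"
    and q :: "'a \<Rightarrow> real"
    and H :: "('x \<Rightarrow> 'a) set"
    and P :: "real set"
  assumes loss_range: "\<And>a y. y \<in> {0, 1} \<Longrightarrow> loss a y \<in> {0..1}"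
    and br: "best_response loss k"
    and q_choice: "\<And>a. q a \<in> conj_argmax loss (slope loss a)"
    and P_sub: "P \<subseteq> {0..1}"
  shows "(\<forall>T x p y. transcript P T x p y \<longrightarrow>
            swap_reg_br P loss H k T x p y
              \<le> swap_reg P (proper_loss loss) (comp_class (action_report loss q) H)
                  (forecast_report loss k) T x p y) \<and>
         (\<forall>\<T> (B :: nat \<Rightarrow> (nat \<Rightarrow> 'x) \<Rightarrow> (nat \<Rightarrow> real) \<Rightarrow> (nat \<Rightarrow> nat) \<Rightarrow> ereal).
            (\<forall>(T, x, p, y)\<in>\<T>. transcript P T x p y) \<longrightarrow>
            (\<forall>(T, x, p, y)\<in>\<T>.
               swap_reg P (proper_loss loss) (comp_class (action_report loss q) H)
                 (forecast_report loss k) T x p y \<le> B T x p y) \<longrightarrow>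
            (\<forall>(T, x, p, y)\<in>\<T>. swap_reg_br P loss H k T x p y \<le> B T x p y))"
proof (intro conjI allI impI)
  show le: "swap_reg_br P loss H k T x p y
      \<le> swap_reg P (proper_loss loss) (comp_class (action_report loss q) H)
          (forecast_report loss k) T x p y"
    if "transcript P T x p y" for T x p y
    using swap_reg_br_le_swap_reg[OF br q_choice P_sub that] .
  show "\<forall>(T, x, p, y)\<in>\<T>. swap_reg_br P loss H k T x p y \<le> B T x p y"
    if "\<forall>(T, x, p, y)\<in>\<T>. transcript P T x p y"
      and "\<forall>(T, x, p, y)\<in>\<T>.
        swap_reg P (proper_loss loss) (comp_class (action_report loss q) H)
          (forecast_report loss k) T x p y \<le> B T x p y"
    for \<T> and B :: "nat \<Rightarrow> (nat \<Rightarrow> 'x) \<Rightarrow> (nat \<Rightarrow> real) \<Rightarrow> (nat \<Rightarrow> nat) \<Rightarrow> ereal"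
    using that by (fast intro: order_trans[OF le])
qed

end
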